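(* If $X$ is a topological space with $\mathrm{pd}(X)<\mathrm{d}(X)$, then $X$ has a neat open subspace $Y$ with $\mathrm{pd}(Y)<\mathrm{d}(Y)$.
   Context: For a topological space $X$ with topology $\tau_X$, a neighborhood assignment on $X$ is a map $U:X\to\tau_X$ with $x\in U(x)$ for all $x\in X$. A set $A\subseteq X$ pins down $U$ if $A\cap U(x)\neq\emptyset$ for all $x\in X$. The pinning down number $\mathrm{pd}(X)$ is the smallest cardinal $\kappa$ such that every neighborhood assignment on $X$ can be pinned down by a subset of $X$ of size $\kappa$. $\mathrm{d}(X)$ is the density of $X$ (the smallest cardinality of a dense subset). The dispersion character $\Delta(X)$ is the smallest cardinality of a non-empty open subset of $X$. A space $X$ is neat if $X\ne\emptyset$ and $|X|=\Delta(X)$. *)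

theory Defs
  imports "HOL-Analysis.Abstract_Topology"
begin

unbundle cardinal_syntax

text \<open>
  Cardinals are cardinal orders in the sense of HOL's cardinal library, taken modulo
  \<^term>\<open>ordIso\<close>. The invariants of a space over \<^typ>\<open>'a\<close> are bounded by the cardinality of the
  space, so relations on \<^typ>\<open>'a\<close> suffice to represent them. The choice below only picks a
  representative: the least cardinal is unique up to \<^term>\<open>ordIso\<close>, and it exists as soon as
  some cardinal on \<^typ>\<open>'a\<close> satisfies the property (if none does, the value is arbitrary).
\<close>

definition is_least_cardinal :: "('a rel \<Rightarrow> bool) \<Rightarrow> 'a rel \<Rightarrow> bool" where
  "is_least_cardinal P \<kappa> \<longleftrightarrow>
     Card_order \<kappa> \<and> P \<kappa> \<and> (\<forall>\<mu>. Card_order \<mu> \<and> P \<mu> \<longrightarrow> \<kappa> \<le>o \<mu>)"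

definition least_cardinal :: "('a rel \<Rightarrow> bool) \<Rightarrow> 'a rel" where
  "least_cardinal P = (SOME \<kappa>. is_least_cardinal P \<kappa>)"

lemma least_cardinal:
  assumes "Card_order \<kappa>" and "P \<kappa>"
  shows "is_least_cardinal P (least_cardinal P)"
  unfolding least_cardinal_def
proof (rule someI_ex)
  show "\<exists>\<kappa>. is_least_cardinal P \<kappa>"
    using exists_minim_Card_order[of "{\<mu>. Card_order \<mu> \<and> P \<mu>}"] assms
    unfolding is_least_cardinal_def by blast
qed

definition neighborhood_assignment :: "'a topology \<Rightarrow> ('a \<Rightarrow> 'a set) \<Rightarrow> bool" where
  "neighborhood_assignment X U \<longleftrightarrow> (\<forall>x \<in> topspace X. openin X (U x) \<and> x \<in> U x)"

definition pins_down :: "'a topology \<Rightarrow> 'a set \<Rightarrow> ('a \<Rightarrow> 'a set) \<Rightarrow> bool" where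
  "pins_down X A U \<longleftrightarrow> A \<subseteq> topspace X \<and> (\<forall>x \<in> topspace X. A \<inter> U x \<noteq> {})"

definition pd :: "'a topology \<Rightarrow> 'a rel" where
  "pd X = least_cardinal
     (\<lambda>\<kappa>. \<forall>U. neighborhood_assignment X U \<longrightarrow> (\<exists>A. pins_down X A U \<and> |A| =o \<kappa>))"

definition density :: "'a topology \<Rightarrow> 'a rel" where
  "density X = least_cardinal
     (\<lambda>\<kappa>. \<exists>D. D \<subseteq> topspace X \<and> X closure_of D = topspace X \<and> |D| =o \<kappa>)"

text \<open>Meaningful for non-empty spaces only, as the empty space has no non-empty open subset.\<close>

definition dispersion_character :: "'a topology \<Rightarrow> 'a rel" where
  "dispersion_character X = least_cardinal (\<lambda>\<kappa>. \<exists>G. openin X G \<and> G \<noteq> {} \<and> |G| =o \<kappa>)"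

definition neat :: "'a topology \<Rightarrow> bool" where
  "neat X \<longleftrightarrow> topspace X \<noteq> {} \<and> |topspace X| =o dispersion_character X"

lemma is_least_cardinal_pd:
  "is_least_cardinal
     (\<lambda>\<kappa>. \<forall>U. neighborhood_assignment X U \<longrightarrow> (\<exists>A. pins_down X A U \<and> |A| =o \<kappa>)) (pd X)"
  unfolding pd_def
proof (rule least_cardinal[OF card_of_Card_order[of "topspace X"]], intro allI impI)
  fix U assume "neighborhood_assignment X U"
  then have "pins_down X (topspace X) U"
    by (auto simp: neighborhood_assignment_def pins_down_def)
  then show "\<exists>A. pins_down X A U \<and> |A| =o |topspace X|"
    by (intro exI[of _ "topspace X"] conjI card_of_refl)
qed

lemma is_least_cardinal_density:
  "is_least_cardinal
     (\<lambda>\<kappa>. \<exists>D. D \<subseteq> topspace X \<and> X closure_of D = topspace X \<and> |D| =o \<kappa>) (density X)"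
  unfolding density_def
  by (rule least_cardinal[OF card_of_Card_order[of "topspace X"]])
     (intro exI[of _ "topspace X"] conjI subset_refl closure_of_topspace card_of_refl)

lemma is_least_cardinal_dispersion_character:
  assumes "topspace X \<noteq> {}"
  shows "is_least_cardinal
     (\<lambda>\<kappa>. \<exists>G. openin X G \<and> G \<noteq> {} \<and> |G| =o \<kappa>) (dispersion_character X)"
  unfolding dispersion_character_def
  by (rule least_cardinal[OF card_of_Card_order[of "topspace X"]])
     (intro exI[of _ "topspace X"] conjI openin_topspace assms card_of_refl)

end

theory Submission
  imports Defs
begin

text \<open>
  Neat open sets form a \<open>\<pi>\<close>-base, so a maximal disjoint family of them has dense union. The
  family has at most \<open>pd X\<close> members. If each member had density at most \<open>pd X\<close>, the union of
  their dense subsets would be a dense set that is finite or of size at most \<open>pd X\<close>; the latter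
  contradicts the assumption, and so does the former because finite density never exceeds
  the pinning down number. So some member \<open>Y\<close> has \<open>d Y > pd X \<ge> pd Y\<close>.
\<close>

section \<open>Subsets of prescribed cardinality\<close>

text \<open>The definition of \<open>pd\<close> asks for pinning sets of size exactly
  \<open>\<kappa>\<close>, whereas constructions only bound sizes from above. The hypothesis
  \<open>\<kappa> \<le>o |Y|\<close> leaves room inside \<open>Y\<close> to enlarge
  \<open>A\<close>.\<close>

lemma ex_subset_between_card_of:
  assumes "A \<subseteq> Y" "|A| \<le>o \<kappa>" "\<kappa> \<le>o |Y|" "Card_order \<kappa>"
  shows "\<exists>B. A \<subseteq> B \<and> B \<subseteq> Y \<and> |B| =o \<kappa>"
proof -
  have "|Field \<kappa>| =o \<kappa>"
    by (rule card_of_Field_ordIso[OF assms(4)])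
  then have "|Field \<kappa>| \<le>o |Y|"
    using assms(3) by (rule ordIso_ordLeq_trans)
  then obtain C where C: "C \<subseteq> Y" "|Field \<kappa>| =o |C|"
    unfolding internalize_card_of_ordLeq2[of "Field \<kappa>" Y] by blast
  have C\<kappa>: "|C| =o \<kappa>"
    by (rule ordIso_transitive[OF ordIso_symmetric[OF C(2)] \<open>|Field \<kappa>| =o \<kappa>\<close>])
  have AC: "|A| \<le>o |C|"
    using assms(2) ordIso_symmetric[OF C\<kappa>] by (rule ordLeq_ordIso_trans)
  show ?thesis
  proof (cases "finite C")
    case True
    then have "finite A" by (rule card_of_ordLeq_finite[OF AC])
    with True AC have "card A \<le> card C"
      using card_of_ordLeq[of A C] card_inj_on_le by blast
    moreover have "card C \<le> card (A \<union> C)"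
      using True \<open>finite A\<close> by (simp add: card_mono)
    \<comment> \<open>The whole of \<open>A \<union> C\<close> may be too large, so \<open>A\<close>
      is filled up with points of \<open>C\<close> only until it has \<open>card C\<close>
      elements.\<close>
    ultimately obtain B where B: "A \<subseteq> B" "B \<subseteq> A \<union> C" "card B = card C"
      using exists_subset_between[of A "card C" "A \<union> C"] True \<open>finite A\<close> by auto
    then have "finite B" using True \<open>finite A\<close> finite_subset by blast
    with True B(3) have "|B| =o |C|"
      using card_of_ordIso[of B C] finite_same_card_bij by blast
    then have "|B| =o \<kappa>" using C\<kappa> by (rule ordIso_transitive)
    with B(1,2) C(1) assms(1) show ?thesis by blast
  next
    case False
    \<comment> \<open>An infinite \<open>C\<close> absorbs \<open>A\<close>, so
      \<open>A \<union> C\<close> itself serves as \<open>B\<close>.\<close>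
    then have "|A \<union> C| \<le>o |C|"
      using card_of_Un_ordLeq_infinite_Field[of "|C|" A C] False AC
      by (simp only: Field_card_of card_of_card_order_on card_of_refl ordIso_imp_ordLeq not_False_eq_True)
    moreover have "|C| \<le>o |A \<union> C|"
      by (rule card_of_mono1) simp
    ultimately have "|A \<union> C| =o |C|"
      by (simp add: ordIso_iff_ordLeq)
    then have "|A \<union> C| =o \<kappa>" using C\<kappa> by (rule ordIso_transitive)
    with C(1) assms(1) show ?thesis by blast
  qed
qed

section \<open>Bounds on the pinning down number\<close>

lemma
  shows Card_order_pd: "Card_order (pd X)"
    and Card_order_density: "Card_order (density X)"
  using is_least_cardinal_pd[of X] is_least_cardinal_density[of X]
  unfolding is_least_cardinal_def by blast+

lemma pinned_down_by_pd:
  assumes "neighborhood_assignment X U"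
  obtains A where "pins_down X A U" "|A| =o pd X"
  using is_least_cardinal_pd[of X] assms unfolding is_least_cardinal_def by blast

lemma pd_le_card_topspace: "pd X \<le>o |topspace X|"
proof -
  have "\<exists>A. pins_down X A U \<and> |A| =o |topspace X|" if "neighborhood_assignment X U" for U
    using that card_of_refl[of "topspace X"] by (intro exI[of _ "topspace X"])
      (auto simp: neighborhood_assignment_def pins_down_def)
  then show ?thesis
    using is_least_cardinal_pd[of X] card_of_Card_order[of "topspace X"]
    unfolding is_least_cardinal_def by blast
qed

text \<open>Padding turns upper bounds into exact sizes as long as the space has at least
  \<open>\<kappa>\<close> points. Otherwise \<open>|topspace X|\<close> lies below
  \<open>\<kappa>\<close>, and it already bounds \<open>pd X\<close>.\<close>

lemma pd_least:
  fixes X :: "'a topology" and \<kappa> :: "'a rel"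
  assumes "Card_order \<kappa>"
    and "\<And>U. neighborhood_assignment X U \<Longrightarrow> \<exists>A. pins_down X A U \<and> |A| \<le>o \<kappa>"
  shows "pd X \<le>o \<kappa>"
proof (cases "\<kappa> \<le>o |topspace X|")
  case True
  have "\<exists>A. pins_down X A U \<and> |A| =o \<kappa>" if U: "neighborhood_assignment X U" for U
  proof -
    obtain A where A: "pins_down X A U" "|A| \<le>o \<kappa>"
      using assms(2)[OF U] by blast
    then obtain B where "A \<subseteq> B" "B \<subseteq> topspace X" "|B| =o \<kappa>"
      using ex_subset_between_card_of[of A "topspace X" \<kappa>] True assms(1)
      unfolding pins_down_def by blast
    with A(1) show ?thesis
      unfolding pins_down_def by (intro exI[of _ B]) blast
  qed
  then show ?thesis
    using is_least_cardinal_pd[of X] assms(1) unfolding is_least_cardinal_def by blast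
next
  case False
  then have "|topspace X| \<le>o \<kappa>"
    using assms(1) ordLeq_total[of \<kappa> "|topspace X|"] card_of_Well_order[of "topspace X"]
    unfolding card_order_on_def by blast
  with pd_le_card_topspace show ?thesis
    by (rule ordLeq_transitive)
qed

text \<open>An assignment on \<open>Y\<close> extends to \<open>X\<close>, because open subsets of
  an open subspace are open in \<open>X\<close>; a set pinning down the extension is then cut down
  to \<open>Y\<close>.\<close>

lemma pd_open_subspace_le:
  assumes "openin X Y"
  shows "pd (subtopology X Y) \<le>o pd X"
proof (rule pd_least[OF Card_order_pd])
  fix U assume U: "neighborhood_assignment (subtopology X Y) U"
  have Y: "topspace (subtopology X Y) = Y"
    using assms by (intro topspace_subtopology_subset openin_subset) auto
  have "neighborhood_assignment X (\<lambda>x. if x \<in> Y then U x else topspace X)"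
    using U assms Y unfolding neighborhood_assignment_def
    by (auto simp: openin_open_subtopology)
  then obtain A where A: "pins_down X A (\<lambda>x. if x \<in> Y then U x else topspace X)" "|A| =o pd X"
    by (rule pinned_down_by_pd)
  \<comment> \<open>Since \<open>A\<close> meets \<open>U x\<close> inside \<open>Y\<close>,
    intersecting \<open>A\<close> with \<open>Y\<close> loses nothing.\<close>
  have "U x \<subseteq> Y" if "x \<in> Y" for x
    using U that assms Y unfolding neighborhood_assignment_def
    by (auto simp: openin_open_subtopology)
  moreover have "A \<inter> U x \<noteq> {}" if "x \<in> Y" for x
  proof -
    have "A \<inter> (if x \<in> Y then U x else topspace X) \<noteq> {}"
      using A(1) that openin_subset[OF assms] unfolding pins_down_def by blast
    with that show ?thesis by simp
  qed
  ultimately have "pins_down (subtopology X Y) (A \<inter> Y) U"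
    unfolding pins_down_def Y by blast
  moreover have "|A \<inter> Y| \<le>o pd X"
    using card_of_mono1[OF Int_lower1] A(2) by (rule ordLeq_ordIso_trans)
  ultimately show "\<exists>A. pins_down (subtopology X Y) A U \<and> |A| \<le>o pd X"
    by (intro exI conjI)
qed

section \<open>Density and disjoint open families\<close>

lemma obtain_dense_density:
  obtains D where "D \<subseteq> topspace X" "X closure_of D = topspace X" "|D| =o density X"
  using is_least_cardinal_density[of X] unfolding is_least_cardinal_def by blast

lemma density_le:
  assumes "D \<subseteq> topspace X" "X closure_of D = topspace X"
  shows "density X \<le>o |D|"
  using is_least_cardinal_density[of X] assms card_of_Card_order[of D] card_of_refl[of D]
  unfolding is_least_cardinal_def by blast

text \<open>Let \<open>U\<close> send each point of a member of \<open>W\<close> to that member. A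
  set pinning down \<open>U\<close> must meet every member, so its image under \<open>U\<close>
  covers \<open>W\<close>.\<close>

lemma card_of_disjoint_open_family_le_pd:
  assumes W: "pairwise disjnt W" "\<And>G. G \<in> W \<Longrightarrow> openin X G \<and> G \<noteq> {}"
  shows "|W| \<le>o pd X"
proof -
  \<comment> \<open>Disjointness makes the described member unique; points outside
    \<open>\<Union>W\<close> receive the whole space as a default.\<close>
  define U where "U x = (if x \<in> \<Union>W then (THE G. G \<in> W \<and> x \<in> G) else topspace X)" for x
  have U: "U x = G" if "G \<in> W" "x \<in> G" for G x
  proof -
    have "(THE G. G \<in> W \<and> x \<in> G) = G"
      using that W(1) by (intro the_equality) (auto simp: pairwise_def disjnt_def)
    then show ?thesis using that by (auto simp: U_def)
  qed
  have "neighborhood_assignment X U"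
    unfolding neighborhood_assignment_def
  proof
    fix x assume "x \<in> topspace X"
    then show "openin X (U x) \<and> x \<in> U x"
      using U W(2) by (cases "x \<in> \<Union>W") (blast, simp add: U_def)
  qed
  then obtain A where A: "pins_down X A U" "|A| =o pd X"
    by (rule pinned_down_by_pd)
  have "W \<subseteq> U ` A"
  proof
    fix G assume G: "G \<in> W"
    then obtain x where x: "x \<in> G" using W(2) by blast
    with G W(2) have "x \<in> topspace X" using openin_subset by blast
    with A(1) U[OF G x] obtain a where "a \<in> A" "a \<in> G"
      unfolding pins_down_def by blast
    with U[OF G] show "G \<in> U ` A" by blast
  qed
  then have "|W| \<le>o |A|"
    by (rule surj_imp_ordLeq)
  then show ?thesis
    using A(2) by (rule ordLeq_ordIso_trans)
qed

text \<open>
  A finite dense set \<open>D\<close> of minimal size is the trace of a disjoint family of open sets, each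
  containing a single point of \<open>D\<close>.
\<close>

lemma density_le_pd_if_finite_dense:
  assumes "finite D" "D \<subseteq> topspace X" "X closure_of D = topspace X"
  shows "density X \<le>o pd X"
proof -
  define dense where "dense E \<longleftrightarrow> E \<subseteq> topspace X \<and> X closure_of E = topspace X" for E
  obtain E where E: "dense E" "finite E" and minim: "\<And>F. F \<subset> E \<Longrightarrow> \<not> dense F"
  proof -
    have "finite D \<and> dense D" using assms by (simp add: dense_def)
    then obtain E where "finite E \<and> dense E" and least: "\<And>F. finite F \<and> dense F \<Longrightarrow> card E \<le> card F"
      using ex_has_least_nat[of "\<lambda>E. finite E \<and> dense E" D card] by blast
    moreover have "\<not> dense F" if "F \<subset> E" for F
    proof
      assume "dense F"
      moreover have "finite F" "card F < card E"
        using that \<open>finite E \<and> dense E\<close> finite_subset psubset_card_mono by blast+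
      ultimately show False using least[of F] by simp
    qed
    ultimately show ?thesis using that[of E] by blast
  qed
  have dense_iff: "dense F \<longleftrightarrow>
      F \<subseteq> topspace X \<and> (\<forall>T. openin X T \<and> T \<noteq> {} \<longrightarrow> F \<inter> T \<noteq> {})" for F
    unfolding dense_def by (simp add: dense_intersects_open)
  have "\<exists>G. openin X G \<and> E \<inter> G = {x}" if "x \<in> E" for x
  proof -
    \<comment> \<open>An open set witnessing that \<open>E - {x}\<close> is not dense still meets
      \<open>E\<close>, hence only in \<open>x\<close>.\<close>
    have "\<not> dense (E - {x})" using that minim by blast
    then obtain G where "openin X G" "G \<noteq> {}" "(E - {x}) \<inter> G = {}"
      using E(1) unfolding dense_iff by blast
    with E(1) show ?thesis unfolding dense_iff by blast
  qed
  then obtain G where G: "\<And>x. x \<in> E \<Longrightarrow> openin X (G x) \<and> E \<inter> G x = {x}"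
    by metis
  have disj: "G x \<inter> G y = {}" if "x \<in> E" "y \<in> E" "x \<noteq> y" for x y
  proof (rule ccontr)
    \<comment> \<open>A point of \<open>E\<close> in this open intersection would equal both
      \<open>x\<close> and \<open>y\<close>.\<close>
    assume "G x \<inter> G y \<noteq> {}"
    moreover have "openin X (G x \<inter> G y)" using G that by blast
    ultimately have "E \<inter> (G x \<inter> G y) \<noteq> {}" using E(1) unfolding dense_iff by blast
    then obtain z where "z \<in> E \<inter> G x" "z \<in> E \<inter> G y" by blast
    with G that show False by simp
  qed
  have "inj_on G E" 
  proof (rule inj_onI)
    fix x y assume "x \<in> E" "y \<in> E" "G x = G y"
    then have "{x} = {y}" using G by metis
    then show "x = y" by simp
  qed
  then have "|E| =o |G ` E|"
    unfolding card_of_ordIso[symmetric] bij_betw_def by blast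
  have "|G ` E| \<le>o pd X"
  proof (rule card_of_disjoint_open_family_le_pd)
    show "pairwise disjnt (G ` E)" using disj by (auto simp: pairwise_def disjnt_def)
    show "openin X H \<and> H \<noteq> {}" if "H \<in> G ` E" for H
      using that G by blast
  qed
  with \<open>|E| =o |G ` E|\<close> have E_le: "|E| \<le>o pd X"
    by (rule ordIso_ordLeq_trans)
  have "density X \<le>o |E|"
    using E(1) density_le[of E X] unfolding dense_def by blast
  then show ?thesis
    using E_le by (rule ordLeq_transitive)
qed

section \<open>Neat open sets and maximal disjoint families\<close>

text \<open>Choose \<open>H\<close> of least cardinality among the non-empty open subsets of
  \<open>G\<close>. Its own non-empty open subsets are competitors in this choice, so none of them
  is smaller.\<close>

lemma ex_neat_open_subset:
  assumes "openin X G" "G \<noteq> {}"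
  obtains H where "openin X H" "H \<noteq> {}" "H \<subseteq> G" "neat (subtopology X H)"
proof -
  let ?R = "{|H| | H. openin X H \<and> H \<noteq> {} \<and> H \<subseteq> G}"
  have "?R \<noteq> {}" using assms by blast
  moreover have "\<forall>r \<in> ?R. Card_order r" using card_of_Card_order by auto
  ultimately obtain r where "r \<in> ?R" and r: "\<forall>r' \<in> ?R. r \<le>o r'"
    using exists_minim_Card_order[of ?R] by blast
  then obtain H where H: "openin X H" "H \<noteq> {}" "H \<subseteq> G" "r = |H|" by blast
  let ?Y = "subtopology X H"
  have top: "topspace ?Y = H"
    using H(1) by (intro topspace_subtopology_subset openin_subset) auto
  have least: "is_least_cardinal (\<lambda>\<kappa>. \<exists>G. openin ?Y G \<and> G \<noteq> {} \<and> |G| =o \<kappa>)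
      (dispersion_character ?Y)"
    using is_least_cardinal_dispersion_character[of ?Y] top H(2) by simp
  then obtain K where K: "openin ?Y K" "K \<noteq> {}" "|K| =o dispersion_character ?Y"
    unfolding is_least_cardinal_def by blast
  have "|K| \<in> ?R"
    using K(1,2) H(1,3) unfolding openin_open_subtopology[OF H(1)] by blast
  then have "|H| \<le>o |K|"
    using r H(4) by blast
  then have "|H| \<le>o dispersion_character ?Y"
    using K(3) by (rule ordLeq_ordIso_trans)
  moreover have "openin ?Y H"
    using top openin_topspace[of ?Y] by simp
  then have "dispersion_character ?Y \<le>o |H|"
    using least H(2) card_of_Card_order[of H] card_of_refl[of H] unfolding is_least_cardinal_def by blast
  ultimately have "neat ?Y"
    unfolding neat_def top using H(2) ordIso_iff_ordLeq[of "|H|"] by blast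
  with H that show thesis by blast
qed

text \<open>Zorn's lemma applies because two members of the union of a chain already lie in a common
  element of the chain. The last conclusion is maximality, tested by inserting one more set.\<close>

lemma ex_maximal_disjoint_family:
  obtains W where "W \<subseteq> \<B>" "pairwise disjnt W"
    "\<And>G. G \<in> \<B> \<Longrightarrow> (\<And>H. H \<in> W \<Longrightarrow> G \<inter> H = {}) \<Longrightarrow> G \<in> W"
proof -
  let ?\<F> = "{W. W \<subseteq> \<B> \<and> pairwise disjnt W}"
  have "\<exists>M \<in> ?\<F>. \<forall>V \<in> ?\<F>. M \<subseteq> V \<longrightarrow> V = M"
  proof (rule subset_Zorn')
    fix C assume "subset.chain ?\<F> C"
    then have C: "C \<subseteq> ?\<F>" "\<And>V V'. V \<in> C \<Longrightarrow> V' \<in> C \<Longrightarrow> V \<subseteq> V' \<or> V' \<subseteq> V"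
      by (auto simp: subset_chain_def)
    have "pairwise disjnt (\<Union>C)"
      unfolding pairwise_def disjnt_def
    proof (intro ballI impI)
      fix G H assume "G \<in> \<Union>C" "H \<in> \<Union>C" "G \<noteq> H"
      then obtain V where "V \<in> C" "G \<in> V" "H \<in> V" using C(2) by blast
      with C(1) have "pairwise disjnt V" by blast
      with \<open>G \<in> V\<close> \<open>H \<in> V\<close> \<open>G \<noteq> H\<close> show "G \<inter> H = {}"
        by (auto simp: pairwise_def disjnt_def)
    qed
    with C(1) show "\<Union>C \<in> ?\<F>" by blast
  qed
  then obtain W where "W \<in> ?\<F>" and "\<forall>V \<in> ?\<F>. W \<subseteq> V \<longrightarrow> V = W"
    by (rule bexE)
  then have W: "W \<subseteq> \<B>" "pairwise disjnt W"
    and max: "\<And>V. V \<subseteq> \<B> \<Longrightarrow> pairwise disjnt V \<Longrightarrow> W \<subseteq> V \<Longrightarrow> V = W"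
    by simp_all
  have "G \<in> W" if "G \<in> \<B>" "\<And>H. H \<in> W \<Longrightarrow> G \<inter> H = {}" for G
  proof -
    have "pairwise disjnt (insert G W)"
      using W(2) that(2) by (auto simp: pairwise_def disjnt_def)
    then show ?thesis using max[of "insert G W"] W(1) that(1) by blast
  qed
  with W that show thesis by blast
qed

section \<open>Gluing dense subsets of neat pieces\<close>

theorem lemma2p2:
  fixes X :: "'a topology"
  assumes "pd X <o density X"
  shows "\<exists>Y. openin X Y \<and> neat (subtopology X Y) \<and>
             pd (subtopology X Y) <o density (subtopology X Y)"
proof (rule ccontr)
  assume contra: "\<not> ?thesis"
  let ?\<B> = "{G. openin X G \<and> G \<noteq> {} \<and> neat (subtopology X G)}"
  have small: "density (subtopology X G) \<le>o pd X" if "G \<in> ?\<B>" for G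
  proof -
    have "\<not> pd (subtopology X G) <o density (subtopology X G)"
      using that contra by blast
    then have "density (subtopology X G) \<le>o pd (subtopology X G)"
      using Card_order_pd[of "subtopology X G"] Card_order_density[of "subtopology X G"]
        not_ordLess_iff_ordLeq[of "density (subtopology X G)" "pd (subtopology X G)"]
      unfolding card_order_on_def by blast
    moreover have "pd (subtopology X G) \<le>o pd X"
      using that pd_open_subspace_le by blast
    ultimately show ?thesis
      by (rule ordLeq_transitive)
  qed
  obtain W where W: "W \<subseteq> ?\<B>" "pairwise disjnt W"
    and max: "\<And>G. G \<in> ?\<B> \<Longrightarrow> (\<And>H. H \<in> W \<Longrightarrow> G \<inter> H = {}) \<Longrightarrow> G \<in> W"
    using ex_maximal_disjoint_family[of ?\<B>] by blast
  \<comment> \<open>Density in the piece \<open>G\<close> is expressed through open sets of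
    \<open>X\<close>, ready for testing the union against open sets of \<open>X\<close>.\<close>
  have "\<forall>G \<in> W. \<exists>D. D \<subseteq> G \<and> (\<forall>T. openin X T \<and> T \<subseteq> G \<and> T \<noteq> {} \<longrightarrow> D \<inter> T \<noteq> {}) \<and> |D| \<le>o pd X"
  proof
    fix G assume "G \<in> W"
    then have G: "G \<in> ?\<B>" using W(1) by blast
    then have top: "topspace (subtopology X G) = G"
      by (intro topspace_subtopology_subset openin_subset) auto
    obtain D where D: "D \<subseteq> topspace (subtopology X G)"
        "subtopology X G closure_of D = topspace (subtopology X G)"
        "|D| =o density (subtopology X G)"
      by (rule obtain_dense_density)
    have "|D| \<le>o pd X"
      using D(3) small[OF G] by (rule ordIso_ordLeq_trans)
    moreover have "D \<inter> T \<noteq> {}" if "openin X T" "T \<subseteq> G" "T \<noteq> {}" for T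
      using D(2) that G unfolding dense_intersects_open by (simp add: openin_open_subtopology)
    ultimately show "\<exists>D. D \<subseteq> G \<and>
        (\<forall>T. openin X T \<and> T \<subseteq> G \<and> T \<noteq> {} \<longrightarrow> D \<inter> T \<noteq> {}) \<and> |D| \<le>o pd X"
      using D(1) top by blast
  qed
  from bchoice[OF this] obtain d where "\<forall>G \<in> W. d G \<subseteq> G \<and>
      (\<forall>T. openin X T \<and> T \<subseteq> G \<and> T \<noteq> {} \<longrightarrow> d G \<inter> T \<noteq> {}) \<and> |d G| \<le>o pd X"
    by (rule exE)
  then have d: "\<And>G. G \<in> W \<Longrightarrow> d G \<subseteq> G"
      "\<And>G T. G \<in> W \<Longrightarrow> openin X T \<Longrightarrow> T \<subseteq> G \<Longrightarrow> T \<noteq> {} \<Longrightarrow> d G \<inter> T \<noteq> {}"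
      "\<And>G. G \<in> W \<Longrightarrow> |d G| \<le>o pd X"
    by simp_all
  define D where "D = (\<Union>G \<in> W. d G)"
  have DX: "D \<subseteq> topspace X"
    using d(1) W(1) openin_subset unfolding D_def by blast
  have D_dense: "X closure_of D = topspace X"
    unfolding dense_intersects_open
  proof (intro allI impI)
    fix T assume T: "openin X T \<and> T \<noteq> {}"
    then obtain H where H: "H \<in> ?\<B>" "H \<subseteq> T"
      using ex_neat_open_subset[of X T] by blast
    \<comment> \<open>If \<open>H\<close> missed every member of \<open>W\<close>, maximality would
      put \<open>H\<close> into \<open>W\<close>, and \<open>H\<close> would be disjoint from itself
      although it is non-empty.\<close>
    obtain G where G: "G \<in> W" "H \<inter> G \<noteq> {}"
      using max[OF H(1)] H(1) by blast
    have "openin X (H \<inter> G)" using H(1) G(1) W(1) by blast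
    with G have "d G \<inter> (H \<inter> G) \<noteq> {}" using d(2) by blast
    with G(1) H(2) show "D \<inter> T \<noteq> {}" unfolding D_def by blast
  qed
  have W_le: "|W| \<le>o pd X"
    using card_of_disjoint_open_family_le_pd[OF W(2)] W(1) by blast
  have "density X \<le>o pd X"
  \<comment> \<open>A union of at most \<open>pd X\<close> sets of size at most \<open>pd X\<close>
    stays within \<open>pd X\<close> only for infinite \<open>pd X\<close>. In the finite case the
    union may be larger, but it is a finite dense set.\<close>
  proof (cases "finite (Field (pd X))")
    case True
    have Field: "pd X =o |Field (pd X)|"
      by (rule ordIso_symmetric[OF card_of_Field_ordIso[OF Card_order_pd]])
    have fin: "|S| \<le>o pd X \<Longrightarrow> finite S" "|\<S>| \<le>o pd X \<Longrightarrow> finite \<S>"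
      for S :: "'a set" and \<S> :: "'a set set"
      using card_of_ordLeq_finite[OF ordLeq_ordIso_trans[OF _ Field] True] by blast+
    have "finite W" using fin(2) W_le by blast
    moreover have "finite (d G)" if "G \<in> W" for G using fin(1) d(3) that by blast
    ultimately have "finite D" unfolding D_def by blast
    then show ?thesis using DX D_dense by (rule density_le_pd_if_finite_dense)
  next
    case False
    then have "|D| \<le>o pd X"
      unfolding D_def using Card_order_pd W_le d(3)
      by (intro card_of_UNION_ordLeq_infinite_Field) auto
    with density_le[OF DX D_dense] show ?thesis
      by (rule ordLeq_transitive)
  qed
  with assms show False
    using not_ordLess_ordLeq[of "pd X" "density X"] by blast
qed

end
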